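(* For every integer $n\ge 1$, the matrix ring over dual numbers $M_n(\mathbb{D})$ is not (von Neumann) regular.
   Context: $\mathbb{D}=\{a+b\epsilon \mid a,b\in\mathbb{R},\ \epsilon^2=0\}$ is the ring of dual numbers, and $M_n(\mathbb{D})$ is the ring of $n\times n$ matrices over $\mathbb{D}$. An element $a$ of a ring $R$ (associative with identity) is (von Neumann) regular if $a=axa$ for some $x\in R$. A ring is regular if every element of it is regular. *)

theory Defs
  imports Complex_Main "Jordan_Normal_Form.Matrix"
begin

datatype dual = Dual (dual_re: real) (dual_eps_part: real)

instantiation dual :: comm_ring_1
begin

definition "0 = Dual 0 0"
definition "1 = Dual 1 0"
definition "x + y = Dual (dual_re x + dual_re y) (dual_eps_part x + dual_eps_part y)"
definition "- x = Dual (- dual_re x) (- dual_eps_part x)"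
definition "x - y = Dual (dual_re x - dual_re y) (dual_eps_part x - dual_eps_part y)"

text \<open>\<open>(a + b \<epsilon>) (c + d \<epsilon>) = a c + (a d + b c) \<epsilon>\<close>, since \<open>\<epsilon>\<^sup>2 = 0\<close>.\<close>
definition "x * y = Dual (dual_re x * dual_re y)
  (dual_re x * dual_eps_part y + dual_eps_part x * dual_re y)"

instance
  by standard
    (simp_all add: zero_dual_def one_dual_def plus_dual_def uminus_dual_def
      minus_dual_def times_dual_def algebra_simps)

end

instantiation dual :: real_algebra_1
begin

definition "scaleR r x = Dual (r * dual_re x) (r * dual_eps_part x)"

instance
  by standard
    (simp_all add: scaleR_dual_def plus_dual_def times_dual_def algebra_simps)

end

definition dual_eps :: dual where
  "dual_eps = Dual 0 1"

lemma dual_eps_squared: "dual_eps ^ 2 = 0"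
  by (simp add: power2_eq_square dual_eps_def times_dual_def zero_dual_def)

lemma Dual_eq: "Dual a b = of_real a + of_real b * dual_eps"
  by (simp add: of_real_def scaleR_dual_def one_dual_def plus_dual_def
      times_dual_def dual_eps_def)

text \<open>The next two notions are meant for \<open>R\<close> satisfying \<^locale>\<open>ring\<close> and \<open>a \<in> carrier R\<close>.\<close>
definition vn_regular_elem :: "('a, 'b) ring_scheme \<Rightarrow> 'a \<Rightarrow> bool" where
  "vn_regular_elem R a \<longleftrightarrow> (\<exists>x\<in>carrier R. a = a \<otimes>\<^bsub>R\<^esub> x \<otimes>\<^bsub>R\<^esub> a)"

definition vn_regular_ring :: "('a, 'b) ring_scheme \<Rightarrow> bool" where
  "vn_regular_ring R \<longleftrightarrow> (\<forall>a\<in>carrier R. vn_regular_elem R a)"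

abbreviation dual_mat_ring :: "nat \<Rightarrow> dual mat ring" where
  "dual_mat_ring n \<equiv> ring_mat TYPE(dual) n ()"

lemma ring_dual_mat_ring: "ring (dual_mat_ring n)"
  by (rule ring_mat)

end

theory Submission
  imports Defs
begin

text \<open>The scalar matrix \<open>\<epsilon> I\<close> is central with square zero, so \<open>(\<epsilon> I) X (\<epsilon> I) = 0\<close> for every \<open>X\<close>,
  whereas \<open>\<epsilon> I \<noteq> 0\<close>.\<close>

theorem theorem3p2:
  fixes n :: nat
  assumes "n \<ge> 1"
  shows "\<not> vn_regular_ring (dual_mat_ring n)"
proof
  let ?E = "dual_eps \<cdot>\<^sub>m 1\<^sub>m n"
  have E: "?E \<in> carrier_mat n n"
    by simp
  assume "vn_regular_ring (dual_mat_ring n)"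
  with E obtain X where X: "X \<in> carrier_mat n n" and EXE: "?E = ?E * X * ?E"
    unfolding vn_regular_ring_def vn_regular_elem_def ring_mat_simps by blast
  \<comment> \<open>Both scalars are moved to the front of \<open>X\<close>, the second one past it
    by commutativity of the dual numbers.\<close>
  have "?E * X * ?E = dual_eps \<cdot>\<^sub>m X * ?E"
    using X by (simp add: mult_smult_assoc_mat[of _ n n _ n])
  also have "\<dots> = dual_eps \<cdot>\<^sub>m (dual_eps \<cdot>\<^sub>m X)"
    using X by (simp add: mult_smult_distrib[of _ n n _ n])
  \<comment> \<open>Entrywise, reassociating \<open>dual_eps * (dual_eps * x)\<close> exposes the
    square of \<open>dual_eps\<close>, which is 0.\<close>
  also have "\<dots> = 0\<^sub>m n n"
    using X dual_eps_squared
    by (intro eq_matI) (auto simp: power2_eq_square mult.assoc[symmetric])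
  finally have "?E $$ (0, 0) = 0\<^sub>m n n $$ (0, 0)"
    using EXE by simp
  \<comment> \<open>As \<open>n \<ge> 1\<close>, the index \<open>(0, 0)\<close> is in range; there
    \<open>?E\<close> has entry \<open>dual_eps\<close>, whose \<open>dual_eps_part\<close> is 1,
    not 0.\<close>
  with assms show False
    by (simp add: dual_eps_def zero_dual_def)
qed

end
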